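(* Let $q\in[1/2,1)$ and let $T\in\mathcal{T}^{|}$ be a random tree with the invariant Galton-Watson distribution $\mathcal{IGW}(q)$. Then the number of edges in $T$ has the probability mass function $$\alpha(n)=\sum_{k=1}^n(-1)^{k-1}\binom{n-1}{k-1}\frac{\Gamma(k/q+1)}{k!\,\Gamma(k/q-k+2)}\,q^k,\qquad n=1,2,\ldots,$$ and the cumulative distribution function $$\mathcal{A}(x)=\sum_{k=1}^{\lfloor x\rfloor}(-1)^{k-1}\binom{\lfloor x\rfloor}{k}\frac{\Gamma(k/q+1)}{k!\,\Gamma(k/q-k+2)}\,q^k,\qquad x\ge 1.$$
   Context: A rooted tree is reduced if it has no vertices of degree 2 except possibly the root, and planted if its root has degree one; the only edge at the root is then called the stem. $\mathcal{T}^{|}$ is the space of finite unlabeled rooted reduced planted trees without planar embedding, together with the empty tree $\phi$ (a root and no edges). For a probability mass function $\{q_k\}_{k\ge0}$ with $q_1=0$ and $\sum_k kq_k\le 1$, $\mathcal{GW}(\{q_k\})$ is the probability measure on $\mathcal{T}^{|}$ induced by the Galton-Watson process that begins with a progenitor (the root) having exactly one offspring, after which every individual independently has $k$ offspring with probability $q_k$. For $q\in[1/2,1)$, $\mathcal{IGW}(q)$ is $\mathcal{GW}(\{q_k\})$ with progeny generating function $Q(z)=\sum_k q_kz^k=z+q(1-z)^{1/q}$. The stem is counted among the edges of $T$. *)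

theory Defs
  imports "HOL-Probability.Probability"
begin

text \<open>
  Finite unlabeled rooted trees without planar embedding: a vertex carries the
  multiset of the subtrees rooted at its offspring.
\<close>

datatype rtree = Node (offspring: "rtree multiset")

primrec num_edges :: "rtree \<Rightarrow> nat" where
  "num_edges (Node M) = (\<Sum>n\<in>#image_mset num_edges M. Suc n)"

text \<open>
  A vertex other than the root is also adjacent to its parent, hence its degree is
  one more than the number of its offspring.
\<close>

inductive no_degree_two :: "rtree \<Rightarrow> bool" where
  "Suc (size M) \<noteq> 2 \<Longrightarrow> (\<And>t. t \<in># M \<Longrightarrow> no_degree_two t) \<Longrightarrow> no_degree_two (Node M)"

definition reduced :: "rtree \<Rightarrow> bool" where
  "reduced t \<longleftrightarrow> (\<forall>s\<in>#offspring t. no_degree_two s)"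

definition planted :: "rtree \<Rightarrow> bool" where
  "planted t \<longleftrightarrow> size (offspring t) = 1"

definition empty_tree :: rtree where
  "empty_tree = Node {#}"

definition planted_trees :: "rtree set" where
  "planted_trees = {t. reduced t \<and> planted t} \<union> {empty_tree}"

text \<open>
  Individuals of the Galton-Watson process carry Ulam-Harris labels: \<open>[]\<close> is the
  progenitor and \<open>u @ [i]\<close>, for \<open>i < \<nu> u\<close>, are the offspring of \<open>u\<close>. The family \<open>\<nu>\<close>
  of offspring numbers is independent; the progenitor has exactly one offspring.
\<close>

definition gw_process :: "nat pmf \<Rightarrow> (nat list \<Rightarrow> nat) measure" where
  "gw_process p = (\<Pi>\<^sub>M u\<in>UNIV. measure_pmf (if u = [] then return_pmf 1 else p))"

text \<open>
  \<open>family_tree \<nu> u t\<close>: the descendants of \<open>u\<close> form the finite tree \<open>t\<close>. It holds for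
  no \<open>t\<close> if \<open>u\<close> has infinitely many descendants.
\<close>

inductive family_tree :: "(nat list \<Rightarrow> nat) \<Rightarrow> nat list \<Rightarrow> rtree \<Rightarrow> bool" for \<nu> where
  "(\<And>i. i < \<nu> u \<Longrightarrow> family_tree \<nu> (u @ [i]) (t i)) \<Longrightarrow>
     family_tree \<nu> u (Node (mset (map t [0..<\<nu> u])))"

lemma family_tree_unique:
  "family_tree \<nu> u s \<Longrightarrow> family_tree \<nu> u t \<Longrightarrow> s = t"
proof (induction arbitrary: t rule: family_tree.induct)
  case (1 u f)
  from 1(3) obtain g where t: "t = Node (mset (map g [0..<\<nu> u]))"
    and g: "\<And>i. i < \<nu> u \<Longrightarrow> family_tree \<nu> (u @ [i]) (g i)"
    by (auto elim: family_tree.cases)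
  have "map f [0..<\<nu> u] = map g [0..<\<nu> u]"
    using 1(2) g by (intro map_cong) auto
  then show ?case unfolding t by (simp only:)
qed

text \<open>
  The value \<open>empty_tree\<close> is a placeholder for the outcomes whose family tree is
  infinite or not reduced. They form a null event whenever \<open>pmf p 1 = 0\<close> and the mean
  of \<open>p\<close> is at most one.
\<close>

definition gw_tree :: "(nat list \<Rightarrow> nat) \<Rightarrow> rtree" where
  "gw_tree \<nu> = (if \<exists>t\<in>planted_trees. family_tree \<nu> [] t
                 then THE t. family_tree \<nu> [] t else empty_tree)"

lemma gw_tree_in_planted_trees: "gw_tree \<nu> \<in> planted_trees"
proof (cases "\<exists>t\<in>planted_trees. family_tree \<nu> [] t")
  case True
  then obtain t where t: "t \<in> planted_trees" "family_tree \<nu> [] t" by blast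
  then have "(THE t. family_tree \<nu> [] t) = t"
    using family_tree_unique by blast
  with t show ?thesis by (simp add: gw_tree_def True)
next
  case False
  then show ?thesis unfolding gw_tree_def planted_trees_def by simp
qed

definition galton_watson :: "nat pmf \<Rightarrow> rtree measure" where
  "galton_watson p = distr (gw_process p) (count_space planted_trees) gw_tree"

definition generating_function :: "nat pmf \<Rightarrow> real \<Rightarrow> real" where
  "generating_function p z = (\<Sum>k. pmf p k * z ^ k)"

definition igw_offspring :: "real \<Rightarrow> nat pmf" where
  "igw_offspring q = (THE p. \<forall>z. \<bar>z\<bar> < 1 \<longrightarrow>
     generating_function p z = z + q * (1 - z) powr (1 / q))"

definition IGW :: "real \<Rightarrow> rtree measure" where
  "IGW q = galton_watson (igw_offspring q)"

end

theory Submission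
  imports Defs
begin

text \<open>
  The law of the tree is read off plane trees: that the process realizes a given finite plane
  tree is a cylinder event, whose probability is a product of offspring probabilities.
  Decomposing a plane tree at its root shows that the generating function \<open>A\<close> of the number of
  edges satisfies \<open>A = s Q(A)\<close>. For \<open>Q(z) = z + q (1 - z)\<^bsup>1/q\<^esup>\<close> this reads
  \<open>A (1 - A)\<^bsup>-1/q\<^esup> = q s / (1 - s)\<close>, so that \<open>A\<close> is the inverse series of \<open>u (1 - u)\<^bsup>-1/q\<^esup>\<close>
  evaluated at \<open>q s / (1 - s)\<close>. The total mass \<open>g = A(1)\<close> satisfies \<open>Q(g) \<le> g\<close>, which forces
  \<open>g = 1\<close> because \<open>Q(z) > z\<close> for \<open>z < 1\<close>.
\<close>

unbundle no vec_syntax and fps_syntax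

section \<open>Inversion of \<open>u (1 - u)\<^bsup>-c\<^esup>\<close>\<close>

text \<open>An n-fold difference kills polynomials of degree below n. The induction removes one
  linear factor: its k-part is absorbed by
  \<open>k * (n choose k) = n * ((n - 1) choose (k - 1))\<close>, which lowers n. Re-indexing by one
  adds \<open>a i\<close> to \<open>b i\<close>, hence the generalization over
  \<open>b\<close>.\<close>

lemma alternating_sum_choose_prod_linear_eq_0:
  fixes a b :: "nat \<Rightarrow> 'a::{comm_ring_1}"
  assumes "m < n"
  shows "(\<Sum>k\<le>n. (-1) ^ k * of_nat (n choose k) * (\<Prod>i<m. a i * of_nat k + b i)) = 0"
  using assms
proof (induction m arbitrary: n b)
  case 0
  then show ?case using choose_alternating_sum[of n, where 'a='a] by simp
next
  case (Suc m)
  obtain l where n: "n = Suc l" and l: "m < l" using Suc.prems by (cases n) auto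
  define R where "R k = (\<Prod>i<m. a i * of_nat k + b i)" for k
  have R_Suc: "R (Suc k) = (\<Prod>i<m. a i * of_nat k + (a i + b i))" for k
    by (simp add: R_def algebra_simps)
  have absorb: "of_nat (Suc k) * of_nat (n choose Suc k) = (of_nat n * of_nat (l choose k) :: 'a)" for k
    unfolding n of_nat_mult[symmetric] by (simp only: Suc_times_binomial)
  have "(\<Sum>k\<le>n. (-1) ^ k * of_nat (n choose k) * (\<Prod>i<Suc m. a i * of_nat k + b i))
     = a m * (\<Sum>k\<le>n. (-1) ^ k * (of_nat k * of_nat (n choose k)) * R k)
       + b m * (\<Sum>k\<le>n. (-1) ^ k * of_nat (n choose k) * R k)"
    unfolding sum_distrib_left sum.distrib[symmetric]
    by (intro sum.cong refl) (simp add: R_def algebra_simps)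
  also have "(\<Sum>k\<le>n. (-1) ^ k * of_nat (n choose k) * R k) = 0"
    unfolding R_def using Suc.IH[of n b] Suc.prems by simp
  also have "(\<Sum>k\<le>n. (-1) ^ k * (of_nat k * of_nat (n choose k)) * R k)
      = (\<Sum>k\<le>l. (-1) ^ Suc k * (of_nat (Suc k) * of_nat (n choose Suc k)) * R (Suc k))"
    unfolding n sum.atMost_Suc_shift by simp
  also have "\<dots> = - of_nat n * (\<Sum>k\<le>l. (-1) ^ k * of_nat (l choose k) * R (Suc k))"
    unfolding absorb sum_distrib_left by (intro sum.cong refl) (simp add: algebra_simps)
  also have "(\<Sum>k\<le>l. (-1) ^ k * of_nat (l choose k) * R (Suc k)) = 0"
    unfolding R_Suc using Suc.IH[of l "\<lambda>i. a i + b i"] l by simp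
  finally show ?case by simp
qed

section \<open>Formal powers of 1 - X and Lagrange inversion\<close>

definition one_minus_X_powr :: "'a::field_char_0 \<Rightarrow> 'a fps" where
  "one_minus_X_powr a = fps_binomial a oo (- fps_X)"

lemma one_minus_X_powr_nth: "one_minus_X_powr a $ n = (-1) ^ n * (a gchoose n)"
  by (simp add: one_minus_X_powr_def fps_compose_uminus')

lemma one_minus_X_powr_add: "one_minus_X_powr (a + b) = one_minus_X_powr a * one_minus_X_powr b"
  by (simp add: one_minus_X_powr_def fps_binomial_add_mult fps_compose_mult_distrib)

lemma one_minus_X_powr_power: "one_minus_X_powr a ^ n = one_minus_X_powr (of_nat n * a)"
  unfolding one_minus_X_powr_def by (subst fps_compose_power) (simp_all add: fps_binomial_power)

lemma one_minus_X_powr_0: "one_minus_X_powr 0 = 1"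
  by (simp add: fps_eq_iff one_minus_X_powr_nth gbinomial_0_left)

lemma one_minus_X_powr_1: "one_minus_X_powr 1 = 1 - fps_X"
  by (simp add: one_minus_X_powr_def fps_binomial_1 fps_compose_add_distrib fps_X_fps_compose_startby0)

lemma one_minus_X_powr_minus_nth:
  "one_minus_X_powr (- a) $ n = pochhammer a n / fact n"
proof -
  have "((-1) ^ n * (-1) ^ n :: 'a) = 1"
    by (simp flip: power_mult_distrib)
  then show ?thesis
    unfolding one_minus_X_powr_nth gbinomial_pochhammer
    by (metis (no_types, lifting) minus_minus mult.assoc mult_1 times_divide_eq_right)
qed

text \<open>The values predicted by Lagrange inversion for the inverse series of
  \<open>u (1 - u)^(-c)\<close>: 1/k times the coefficient of \<open>u^(k - 1)\<close> in
  \<open>(1 - u)^(k c)\<close>.\<close>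

definition lagrange_coeff :: "'a::field_char_0 \<Rightarrow> nat \<Rightarrow> 'a" where
  "lagrange_coeff c k = (if k = 0 then 0 else (-1) ^ (k - 1) * (of_nat k * c gchoose (k - 1)) / of_nat k)"

text \<open>The products run over x - k + 1, ..., x and x, ..., x + l - 1. They overlap in x only,
  so together they form one run of n factors times an extra x. If one product is empty, x is an end
  factor of the other.\<close>

lemma pochhammer_split_around:
  fixes x :: "'a::field_char_0"
  assumes "k + l = Suc n"
  shows "pochhammer (x - of_nat k + 1) k * pochhammer x l = x * pochhammer (x - of_nat k + 1) n"
proof (cases l)
  case 0
  then have "k = Suc n" using assms by simp
  then show ?thesis using 0 by (simp add: pochhammer_rec')
next
  case (Suc l')
  then have n: "n = k + l'" using assms by simp
  show ?thesis
    unfolding Suc n pochhammer_product' by (simp add: pochhammer_rec)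
qed

text \<open>
  The coefficient of \<open>u\<^bsup>n\<^esup>\<close> on the left hand side is an alternating binomial sum of
  a product of only \<open>n - 2\<close> factors linear in the index, hence vanishes for \<open>n \<ge> 2\<close>.
\<close>
lemma lagrange_coeff_compose:
  fixes c :: "'a::field_char_0"
  shows "Abs_fps (lagrange_coeff c) oo (fps_X * one_minus_X_powr (- c)) = fps_X"
proof (rule fps_ext)
  fix n
  let ?F = "fps_X * one_minus_X_powr (- c)"
  have F: "(?F ^ k) $ n = (if n < k then 0 else pochhammer (of_nat k * c) (n - k) / fact (n - k))" for k
    using one_minus_X_powr_minus_nth[of "of_nat k * c"]
    by (simp add: power_mult_distrib one_minus_X_powr_power fps_X_power_mult_nth)
  have comp: "(Abs_fps (lagrange_coeff c) oo ?F) $ n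
      = (\<Sum>k=0..n. lagrange_coeff c k * (pochhammer (of_nat k * c) (n - k) / fact (n - k)))"
    unfolding fps_compose_nth by (intro sum.cong refl) (simp add: F)
  consider "n = 0" | "n = 1" | m where "n = Suc (Suc m)"
    by (metis One_nat_def old.nat.exhaust)
  then show "(Abs_fps (lagrange_coeff c) oo ?F) $ n = fps_X $ n"
  proof cases
    case 3
    define N where "N = Suc m"
    have n: "n = Suc N" by (simp add: 3 N_def)
    have summand: "lagrange_coeff c (Suc k) * (pochhammer (of_nat (Suc k) * c) (N - k) / fact (N - k))
        = (c / fact N) * ((-1) ^ k * of_nat (N choose k) *
             (\<Prod>i<m. (c - 1) * of_nat k + (c + 1 + of_nat i)))" if "k \<le> N" for k
    proof -
      define x where "x = of_nat (Suc k) * c"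
      have "pochhammer (x - of_nat k + 1) k * pochhammer x (N - k) = x * pochhammer (x - of_nat k + 1) m"
        by (rule pochhammer_split_around) (use that in \<open>simp add: N_def\<close>)
      \<comment> \<open>As \<open>x = (k + 1) c\<close>, each factor \<open>x - k + 1 + i\<close> is
        linear in k. There are \<open>m = N - 1\<close> of them, one fewer than the order N of the
        difference.\<close>
      also have "pochhammer (x - of_nat k + 1) m = (\<Prod>i<m. (c - 1) * of_nat k + (c + 1 + of_nat i))"
        unfolding pochhammer_prod by (intro prod.cong) (auto simp: x_def algebra_simps)
      finally have *: "pochhammer (x - of_nat k + 1) k * pochhammer x (N - k)
        = x * (\<Prod>i<m. (c - 1) * of_nat k + (c + 1 + of_nat i))" (is "?p * ?p' = x * ?P") .
      have "lagrange_coeff c (Suc k) * (pochhammer (of_nat (Suc k) * c) (N - k) / fact (N - k))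
         = (-1) ^ k * (?p * ?p') / (of_nat (Suc k) * fact k * fact (N - k))"
        unfolding lagrange_coeff_def gbinomial_pochhammer' x_def[symmetric]
        by (simp add: mult.assoc mult.commute mult.left_commute)
      also have "\<dots> = (-1) ^ k * c * ?P / (fact k * fact (N - k))"
        unfolding * by (simp add: x_def del: of_nat_Suc)
      also have "\<dots> = (c / fact N) * ((-1) ^ k * of_nat (N choose k) * ?P)"
        using that by (simp add: binomial_fact)
      finally show ?thesis .
    qed
    have "(Abs_fps (lagrange_coeff c) oo ?F) $ n
        = (\<Sum>k\<le>N. lagrange_coeff c (Suc k) * (pochhammer (of_nat (Suc k) * c) (N - k) / fact (N - k)))"
      unfolding comp unfolding n atLeast0AtMost sum.atMost_Suc_shift by (simp add: lagrange_coeff_def)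
    also have "\<dots> = (c / fact N) * (\<Sum>k\<le>N. (-1) ^ k * of_nat (N choose k) *
             (\<Prod>i<m. (c - 1) * of_nat k + (c + 1 + of_nat i)))"
      unfolding sum_distrib_left by (intro sum.cong refl summand) simp
    also have "\<dots> = 0"
      using alternating_sum_choose_prod_linear_eq_0[of m N "\<lambda>_. c - 1" "\<lambda>i. c + 1 + of_nat i"]
      by (simp add: N_def)
    finally show ?thesis by (simp add: n N_def)
  next
    case 2
    then show ?thesis unfolding comp by (simp add: lagrange_coeff_def)
  qed (simp add: lagrange_coeff_def)
qed

text \<open>The k-th power of X / (1 - X) counts compositions of n into k positive parts. The case
  \<open>n = 0\<close> is separate because truncated subtraction would give 1 instead of 0 at
  \<open>k = 1\<close>.\<close>

lemma X_over_one_minus_X_power_nth: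
  assumes "k \<ge> 1"
  shows "((fps_X * one_minus_X_powr (- 1 :: 'a::field_char_0)) ^ k) $ n =
    (if n = 0 then 0 else of_nat ((n - 1) choose (k - 1)))"
proof -
  have "((fps_X * one_minus_X_powr (- 1 :: 'a)) ^ k) $ n
      = (if n < k then 0 else pochhammer (of_nat k) (n - k) / fact (n - k))"
    using one_minus_X_powr_minus_nth[of "of_nat k :: 'a"]
    by (simp add: power_mult_distrib one_minus_X_powr_power fps_X_power_mult_nth)
  also have "\<dots> = (if n = 0 then 0 else of_nat ((n - 1) choose (k - 1)))"
  proof (cases "n < k")
    case False
    then have "pochhammer (of_nat k) (n - k) / fact (n - k) = (of_nat (n - 1) gchoose (n - k) :: 'a)"
      using assms unfolding gbinomial_pochhammer' by (simp add: of_nat_diff)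
    also have "\<dots> = of_nat ((n - 1) choose (n - k))"
      by (simp add: binomial_gbinomial)
    also have "(n - 1) choose (n - k) = (n - 1) choose (k - 1)"
      using False assms by (subst binomial_symmetric) auto
    finally show ?thesis using False assms by auto
  qed (use assms in \<open>auto simp: binomial_eq_0\<close>)
  finally show ?thesis .
qed

lemma fps_tree_equation_solution:
  fixes A :: "'a::field_char_0 fps" and q c :: 'a
  assumes eq: "A = fps_X * ((fps_X + fps_const q * one_minus_X_powr c) oo A)"
  shows "A $ n = (\<Sum>k=1..n. lagrange_coeff c k * q ^ k * of_nat ((n - 1) choose (k - 1)))"
proof -
  have A0: "A $ 0 = 0" using arg_cong[OF eq, of "\<lambda>f. f $ 0"] by simp
  let ?F = "fps_X * one_minus_X_powr (- c)"
  let ?W = "fps_X * one_minus_X_powr (- 1) :: 'a fps"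
  have inv: "one_minus_X_powr a * one_minus_X_powr (- a) = 1" for a :: 'a
    by (simp flip: one_minus_X_powr_add add: one_minus_X_powr_0)
  have "A = fps_X * A + fps_const q * fps_X * (one_minus_X_powr c oo A)"
    using eq A0 by (simp add: fps_compose_add_distrib fps_compose_mult_distrib algebra_simps
        fps_X_fps_compose_startby0)
  then have "one_minus_X_powr 1 * A = fps_const q * fps_X * (one_minus_X_powr c oo A)"
    by (simp add: one_minus_X_powr_1 algebra_simps)
  \<comment> \<open>Multiplying by \<open>(1 - X)^(-1)\<close> and \<open>(1 - A)^(-c)\<close> takes
    the place of division; opposite powers then cancel.\<close>
  then have "(one_minus_X_powr 1 * one_minus_X_powr (- 1)) * (A * (one_minus_X_powr (- c) oo A))
      = fps_const q * ?W * ((one_minus_X_powr c oo A) * (one_minus_X_powr (- c) oo A))"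
    by (simp add: algebra_simps)
  then have FA: "?F oo A = fps_const q * ?W"
    by (simp add: inv A0 fps_compose_mult_distrib[symmetric] )
       (simp add: A0 fps_compose_mult_distrib)
  \<comment> \<open>Composition is associative here since neither \<open>?F\<close> nor
    \<open>A\<close> has a constant term.\<close>
  have "A = (Abs_fps (lagrange_coeff c) oo ?F) oo A"
    by (simp add: lagrange_coeff_compose A0)
  also have "\<dots> = Abs_fps (lagrange_coeff c) oo (?F oo A)"
    by (subst fps_compose_assoc) (simp_all add: A0)
  also have "\<dots> = Abs_fps (lagrange_coeff c) oo (fps_const q * ?W)" by (simp only: FA)
  finally have A: "A = Abs_fps (lagrange_coeff c) oo (fps_const q * ?W)" .
  have "A $ n = (\<Sum>k=0..n. lagrange_coeff c k * (q ^ k * (?W ^ k) $ n))"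
    by (subst A) (simp add: fps_compose_nth power_mult_distrib[of "fps_const q"])
  also have "\<dots> = (\<Sum>k=1..n. lagrange_coeff c k * (q ^ k * (?W ^ k) $ n))"
    by (simp add: sum.atLeast_Suc_atMost lagrange_coeff_def)
  also have "\<dots> = (\<Sum>k=1..n. lagrange_coeff c k * q ^ k * of_nat ((n - 1) choose (k - 1)))"
    by (intro sum.cong refl) (subst X_over_one_minus_X_power_nth, auto)
  finally show ?thesis .
qed

section \<open>The offspring distribution\<close>

text \<open>Once all coefficients below n vanish, division by \<open>x^n\<close> leaves a power
  series that is 0 away from the origin and tends to \<open>a n\<close> there.\<close>

lemma powser_sums_0_imp_coeff_0:
  fixes a :: "nat \<Rightarrow> 'a::{real_normed_field, banach}"
  assumes "s > 0" and sums: "\<And>x. norm x < s \<Longrightarrow> (\<lambda>n. a n * x ^ n) sums 0"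
  shows "a n = 0"
proof (induction n rule: less_induct)
  case (less n)
  have "(\<lambda>k. a (k + n) * x ^ k) sums 0" if "x \<noteq> 0" "norm x < s" for x
  proof -
    have "(\<lambda>k. a (k + n) * x ^ (k + n)) sums (0 - (\<Sum>i<n. a i * x ^ i))"
      by (rule sums_split_initial_segment[OF sums[OF that(2)]])
    also have "(\<Sum>i<n. a i * x ^ i) = 0" by (simp add: less)
    finally have "(\<lambda>k. inverse (x ^ n) * (a (k + n) * x ^ (k + n))) sums (inverse (x ^ n) * 0)"
      by (intro sums_mult) simp
    then show ?thesis using that by (simp add: power_add field_simps)
  qed
  then have "((\<lambda>x. 0) \<longlongrightarrow> a (0 + n)) (at (0::'a))"
    by (rule powser_limit_0_strong[OF assms(1)])
  then show "a n = 0" by (simp add: tendsto_const_iff)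
qed

lemma generating_function_sums:
  assumes "\<bar>z\<bar> \<le> 1"
  shows "(\<lambda>k. pmf p k * z ^ k) sums generating_function p z"
proof -
  have "summable (pmf p)"
    using integrable_pmf[of UNIV p] by (simp add: integrable_count_space_nat_iff)
  then have "summable (\<lambda>k. pmf p k * z ^ k)"
    by (rule summable_comparison_test'[where N = 0])
       (use assms in \<open>auto simp: abs_mult power_abs mult_left_le power_le_one\<close>)
  then show ?thesis by (simp add: generating_function_def summable_sums)
qed

text \<open>Provides the uniqueness behind the definite description in
  \<open>igw_offspring\<close>.\<close>

lemma generating_function_inject:
  assumes "\<And>z. \<bar>z\<bar> < 1 \<Longrightarrow> generating_function p z = generating_function p' z"
  shows "p = p'"
proof (rule pmf_eqI)
  fix k
  have "(\<lambda>n. (pmf p n - pmf p' n) * z ^ n) sums 0" if "norm z < 1" for z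
    using sums_diff[OF generating_function_sums[of z p] generating_function_sums[of z p']] that
    by (simp add: assms left_diff_distrib)
  from powser_sums_0_imp_coeff_0[of 1, OF _ this] show "pmf p k = pmf p' k" by simp
qed

section \<open>The Taylor coefficients of Q form a probability distribution\<close>

context
  fixes q :: real
  assumes q: "1 / 2 \<le> q" "q < 1"
begin

definition igw_coeff :: "nat \<Rightarrow> real" where
  "igw_coeff k = (fps_X + fps_const q * one_minus_X_powr (1 / q)) $ k"

lemma igw_coeff_sums:
  assumes "\<bar>z\<bar> < 1"
  shows "(\<lambda>k. igw_coeff k * z ^ k) sums (z + q * (1 - z) powr (1 / q))"
proof -
  have "(\<lambda>k. (if k = 1 then z else 0) + q * ((1 / q gchoose k) * (- z) ^ k))
      sums (z + q * (1 + - z) powr (1 / q))"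
    by (intro sums_add sums_mult gen_binomial_real sums_single) (use assms in simp)
  also have "(\<lambda>k. (if k = 1 then z else 0) + q * ((1 / q gchoose k) * (- z) ^ k))
      = (\<lambda>k. igw_coeff k * z ^ k)"
    by (auto simp: igw_coeff_def one_minus_X_powr_nth algebra_simps power_minus[of z] fun_eq_iff)
  finally show ?thesis by simp
qed

lemma igw_coeff_1: "igw_coeff 1 = 0"
  using q by (simp add: igw_coeff_def one_minus_X_powr_nth)

text \<open>For k >= 2 the coefficient is q / k! times the rising factorial of -1/q. The first two
  factors -1/q and 1 - 1/q are negative; the others start at 2 - 1/q, which is nonnegative because q
  >= 1/2.\<close>

lemma igw_coeff_nonneg: "igw_coeff k \<ge> 0"
proof -
  consider "k = 0" | "k = 1" | m where "k = Suc (Suc m)"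
    by (metis One_nat_def old.nat.exhaust)
  then show ?thesis
  proof cases
    case 3
    have "pochhammer (- (1 / q)) k = (1 / q) * (1 / q - 1) * pochhammer (2 - 1 / q) m"
      by (simp add: 3 pochhammer_rec algebra_simps)
    moreover have "1 / q \<le> 2" using q by (simp add: field_simps)
    then have "pochhammer (2 - 1 / q) m \<ge> 0"
      unfolding pochhammer_prod by (intro prod_nonneg) auto
    ultimately have "pochhammer (- (1 / q)) k \<ge> 0"
      using q by simp
    then show ?thesis
      using q 3 one_minus_X_powr_minus_nth[of "- (1 / q)" k]
      by (simp add: igw_coeff_def one_minus_X_powr_nth gbinomial_pochhammer)
  next
    case 2
    then show ?thesis using igw_coeff_1 by simp
  qed (use q in \<open>simp add: igw_coeff_def one_minus_X_powr_nth\<close>)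
qed

text \<open>Abel's argument for nonnegative coefficients as z tends to 1 from below: partial sums
  stay below Q(z) <= z + (1 - z) = 1, and conversely z <= Q(z) bounds the total from below.\<close>

lemma igw_coeff_sums_1: "igw_coeff sums 1"
proof -
  have partial: "sum igw_coeff {..<n} \<le> 1" for n
  proof (rule tendsto_upperbound)
    have "((\<lambda>z. \<Sum>k<n. igw_coeff k * z ^ k) \<longlongrightarrow> (\<Sum>k<n. igw_coeff k * 1 ^ k)) (at_left 1)"
      by (intro tendsto_intros)
    then show "((\<lambda>z. \<Sum>k<n. igw_coeff k * z ^ k) \<longlongrightarrow> sum igw_coeff {..<n}) (at_left 1)"
      by simp
    have "(\<Sum>k<n. igw_coeff k * z ^ k) \<le> 1" if z: "z \<in> {0<..<1}" for z
    proof -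
      have "(\<Sum>k<n. igw_coeff k * z ^ k) \<le> (\<Sum>k. igw_coeff k * z ^ k)"
        using z igw_coeff_sums[of z] by (intro sum_le_suminf) (auto simp: sums_iff igw_coeff_nonneg)
      also have "\<dots> = z + q * (1 - z) powr (1 / q)"
        using z igw_coeff_sums[of z] by (simp add: sums_iff)
      also have "q * (1 - z) powr (1 / q) \<le> 1 * (1 - z) powr 1"
        using q z by (intro mult_mono powr_mono') auto
      finally show ?thesis using z by simp
    qed
    then show "\<forall>\<^sub>F z in at_left 1. (\<Sum>k<n. igw_coeff k * z ^ k) \<le> 1"
      using eventually_at_left_real[of 0 1] by (auto elim!: eventually_mono)
  qed simp
  then have summable: "summable igw_coeff"
    by (intro summableI_nonneg_bounded[where x = 1] igw_coeff_nonneg)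
  have "z \<le> suminf igw_coeff" if "0 < z" "z < 1" for z
  proof -
    have "z \<le> z + q * (1 - z) powr (1 / q)" using q by simp
    also have "\<dots> = (\<Sum>k. igw_coeff k * z ^ k)"
      using that igw_coeff_sums[of z] by (simp add: sums_iff)
    also have "\<dots> \<le> suminf igw_coeff"
      using that igw_coeff_sums[of z] summable
      by (intro suminf_le) (auto simp: sums_iff mult_left_le power_le_one igw_coeff_nonneg)
    finally show ?thesis .
  qed
  then have "1 \<le> suminf igw_coeff"
    by (meson dense_le_bounded zero_less_one)
  moreover have "suminf igw_coeff \<le> 1"
    by (intro suminf_le_const summable partial)
  ultimately show ?thesis using summable by (simp add: sums_iff)
qed

lemma pmf_igw_offspring: "pmf (igw_offspring q) = igw_coeff"
proof -
  define p where "p = embed_pmf igw_coeff"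
  have "(\<integral>\<^sup>+k. ennreal (igw_coeff k) \<partial>count_space UNIV) = 1"
    using suminf_ennreal_eq[OF igw_coeff_nonneg igw_coeff_sums_1]
    by (simp add: nn_integral_count_space_nat)
  then have p: "pmf p = igw_coeff"
    unfolding p_def by (intro ext pmf_embed_pmf igw_coeff_nonneg)
  have gf: "generating_function p z = z + q * (1 - z) powr (1 / q)" if "\<bar>z\<bar> < 1" for z
    using igw_coeff_sums[OF that] by (simp add: generating_function_def p sums_iff)
  have "igw_offspring q = p"
    unfolding igw_offspring_def
  proof (rule the_equality)
    show "\<forall>z. \<bar>z\<bar> < 1 \<longrightarrow> generating_function p z = z + q * (1 - z) powr (1 / q)"
      using gf by blast
    show "p' = p" if "\<forall>z. \<bar>z\<bar> < 1 \<longrightarrow> generating_function p' z = z + q * (1 - z) powr (1 / q)" for p'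
      by (rule generating_function_inject) (use gf that in simp)
  qed
  then show ?thesis using p by simp
qed

lemma fps_igw_offspring:
  "Abs_fps (pmf (igw_offspring q)) = fps_X + fps_const q * one_minus_X_powr (1 / q)"
  by (rule fps_ext) (simp only: pmf_igw_offspring igw_coeff_def fps_nth_Abs_fps)

lemma pmf_igw_offspring_1: "pmf (igw_offspring q) 1 = 0"
  by (simp only: pmf_igw_offspring igw_coeff_1)

lemma generating_function_igw_offspring:
  "\<bar>z\<bar> < 1 \<Longrightarrow> generating_function (igw_offspring q) z = z + q * (1 - z) powr (1 / q)"
  using igw_coeff_sums[of z] by (simp add: generating_function_def pmf_igw_offspring sums_iff)

end

section \<open>Plane trees\<close>

text \<open>With ordered offspring a tree prescribes the offspring number at definite Ulam-Harris
  labels; a multiset of subtrees would leave the labels open.\<close>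

datatype plane_tree = Plane (subtrees: "plane_tree list")

primrec n_vertices :: "plane_tree \<Rightarrow> nat" where
  "n_vertices (Plane ts) = Suc (sum_list (map n_vertices ts))"

primrec forget :: "plane_tree \<Rightarrow> rtree" where
  "forget (Plane ts) = Node (mset (map forget ts))"

primrec weight :: "nat pmf \<Rightarrow> plane_tree \<Rightarrow> real" where
  "weight p (Plane ts) = pmf p (length ts) * prod_list (map (weight p) ts)"

text \<open>
  The pairs of an Ulam-Harris label and the offspring number that a family of offspring
  numbers must have there in order that the descendants of \<open>u\<close> form the given plane tree.
\<close>
primrec labels :: "plane_tree \<Rightarrow> nat list \<Rightarrow> (nat list \<times> nat) set" where
  "labels (Plane ts) = (\<lambda>u. insert (u, length ts) (\<Union>i<length ts. (map labels ts ! i) (u @ [i])))"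

lemma labels_Plane:
  "labels (Plane ts) u = insert (u, length ts) (\<Union>i<length ts. labels (ts ! i) (u @ [i]))"
  by simp

instance plane_tree :: countable by countable_datatype

lemma n_vertices_pos: "n_vertices t > 0"
  by (cases t) simp

lemma weight_nonneg: "weight p t \<ge> 0"
  by (induction t) (auto intro!: mult_nonneg_nonneg prod_list_nonneg)

text \<open>Every vertex but the root has an edge to its parent. Adding a stem compensates the
  difference, so the edges of a planted tree correspond to the vertices above its root.\<close>

lemma num_edges_forget: "Suc (num_edges (forget t)) = n_vertices t"
proof (induction t)
  case (Plane ts)
  have "(\<Sum>s\<in>#mset (map forget ts). Suc (num_edges s)) = sum_list (map (\<lambda>t. Suc (num_edges (forget t))) ts)"
    by (induction ts) auto
  also have "\<dots> = sum_list (map n_vertices ts)"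
    using Plane by (intro arg_cong[where f = sum_list] map_cong) auto
  finally show ?case
    by (simp add: image_mset.compositionality comp_def)
qed

section \<open>Generating function of the number of vertices\<close>

definition trees_of_size :: "nat \<Rightarrow> plane_tree set" where
  "trees_of_size n = {t. n_vertices t = n}"

definition forests :: "nat \<Rightarrow> plane_tree list set" where
  "forests n = {ts. sum_list (map n_vertices ts) = n}"

lemma trees_of_size_0: "trees_of_size 0 = {}"
  using n_vertices_pos by (auto simp: trees_of_size_def)

lemma trees_of_size_Suc: "trees_of_size (Suc n) = Plane ` forests n"
proof (intro set_eqI)
  show "t \<in> trees_of_size (Suc n) \<longleftrightarrow> t \<in> Plane ` forests n" for t
    by (cases t) (auto simp: trees_of_size_def forests_def)
qed

text \<open>A nonempty forest is determined by the subtrees of its first tree and by the remaining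
  trees; both are forests with fewer vertices, as the first root is removed.\<close>

lemma finite_forests: "finite (forests n)"
proof (induction n rule: less_induct)
  case (less n)
  let ?S = "\<Union>i<n. (\<lambda>(us, ts). Plane us # ts) ` (forests i \<times> forests (n - Suc i))"
  have "forests n \<subseteq> insert [] ?S"
  proof
    fix ts assume ts: "ts \<in> forests n"
    show "ts \<in> insert [] ?S"
    proof (cases ts)
      case (Cons t ts')
      obtain us where t: "t = Plane us" by (cases t)
      define i where "i = sum_list (map n_vertices us)"
      have "us \<in> forests i" "ts' \<in> forests (n - Suc i)" "i < n"
        using ts by (auto simp: forests_def Cons t i_def)
      then show ?thesis unfolding Cons t by force
    qed simp
  qed
  moreover have "finite (insert [] ?S)"
    using less by (auto intro!: finite_cartesian_product)
  ultimately show ?case by (rule finite_subset)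
qed

lemma finite_trees_of_size: "finite (trees_of_size n)"
  by (cases n) (simp_all add: trees_of_size_0 trees_of_size_Suc finite_forests)

definition size_fps :: "nat pmf \<Rightarrow> real fps" where
  "size_fps p = Abs_fps (\<lambda>n. \<Sum>t\<in>trees_of_size n. weight p t)"

text \<open>Weights multiply over a forest, so convolution splits off the first tree: a forest of k
  + 1 trees corresponds to the size of its head, the head and the tail.\<close>

lemma size_fps_power_nth:
  "(size_fps p ^ k) $ n = (\<Sum>ts | ts \<in> forests n \<and> length ts = k. prod_list (map (weight p) ts))"
proof (induction k arbitrary: n)
  case 0
  have "{ts. ts \<in> forests n \<and> length ts = 0} = (if n = 0 then {[]} else {})"
    by (auto simp: forests_def)
  then show ?case by simp
next
  case (Suc k)
  let ?F = "\<lambda>n k. {ts. ts \<in> forests n \<and> length ts = k}"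
  have fin: "finite (?F n k)" for n
    using finite_forests by simp
  have "(size_fps p ^ Suc k) $ n
      = (\<Sum>i=0..n. (\<Sum>t\<in>trees_of_size i. weight p t) * (\<Sum>ts\<in>?F (n - i) k. prod_list (map (weight p) ts)))"
    unfolding power_Suc fps_mult_nth Suc.IH by (simp add: size_fps_def)
  also have "\<dots> = (\<Sum>(i, t, ts)\<in>(SIGMA i:{0..n}. trees_of_size i \<times> ?F (n - i) k).
                     weight p t * prod_list (map (weight p) ts))"
    by (simp add: sum_product sum.cartesian_product sum.Sigma finite_trees_of_size fin)
  also have "\<dots> = (\<Sum>ts\<in>?F n (Suc k). prod_list (map (weight p) ts))"
    by (rule sum.reindex_bij_witness[where i = "\<lambda>ts. (n_vertices (hd ts), hd ts, tl ts)"
          and j = "\<lambda>(i, t, ts). t # ts"])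
       (auto simp: trees_of_size_def forests_def length_Suc_conv)
  finally show ?case .
qed

text \<open>Removing the root leaves a forest with n vertices, grouped here by its length. The
  length is at most n because every tree has a vertex.\<close>

lemma size_fps_Suc: "size_fps p $ Suc n = (\<Sum>k=0..n. pmf p k * (size_fps p ^ k) $ n)"
proof -
  have inj: "inj_on Plane A" for A
    by (auto intro: inj_onI)
  have len: "length ts \<le> n" if "ts \<in> forests n" for ts
  proof -
    have "length ts \<le> sum_list (map n_vertices ts)"
    proof (induction ts)
      case (Cons t ts)
      then show ?case using n_vertices_pos[of t] by simp
    qed simp
    then show ?thesis using that by (simp add: forests_def)
  qed
  have "size_fps p $ Suc n = (\<Sum>ts\<in>forests n. pmf p (length ts) * prod_list (map (weight p) ts))"
    by (simp add: size_fps_def trees_of_size_Suc sum.reindex[OF inj])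
  also have "\<dots> = (\<Sum>k=0..n. \<Sum>ts | ts \<in> forests n \<and> length ts = k.
                     pmf p (length ts) * prod_list (map (weight p) ts))"
    using finite_forests len by (intro sum.group[symmetric]) auto
  also have "\<dots> = (\<Sum>k=0..n. pmf p k * (size_fps p ^ k) $ n)"
    by (intro sum.cong refl) (simp add: size_fps_power_nth sum_distrib_left)
  finally show ?thesis .
qed

lemma size_fps_0: "size_fps p $ 0 = 0"
  by (simp add: size_fps_def trees_of_size_0)

lemma size_fps_nonneg: "size_fps p $ n \<ge> 0"
  by (simp add: size_fps_def sum_nonneg weight_nonneg)

lemma size_fps_equation: "size_fps p = fps_X * (Abs_fps (pmf p) oo size_fps p)"
proof (rule fps_ext)
  show "size_fps p $ n = (fps_X * (Abs_fps (pmf p) oo size_fps p)) $ n" for n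
    by (cases n) (simp_all add: size_fps_0 size_fps_Suc fps_compose_nth)
qed

text \<open>
  Equality holds, but the inequality suffices and follows from the partial sums of the
  generating function without interchanging two infinite sums.
\<close>
lemma generating_function_total_mass_le:
  assumes sums: "fps_nth (size_fps p) sums g" and "g \<le> 1"
  shows "generating_function p g \<le> g"
proof -
  have "g \<ge> 0" using sums size_fps_nonneg by (metis sums_le sums_zero)
  \<comment> \<open>Repeated Cauchy products of nonnegative series: the coefficients of the k-th
    power add up to \<open>g ^ k\<close>.\<close>
  have power: "(\<lambda>n. (size_fps p ^ k) $ n) sums g ^ k \<and> (\<forall>n. (size_fps p ^ k) $ n \<ge> 0)" for k
  proof (induction k)
    case 0
    have "(\<lambda>n. (1 :: real fps) $ n) sums 1"
      using sums_single[of 0 "\<lambda>_. 1 :: real"] by (simp add: fps_one_nth)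
    then show ?case by simp
  next
    case (Suc k)
    have "(\<lambda>n. \<Sum>i\<le>n. size_fps p $ i * (size_fps p ^ k) $ (n - i)) sums
        ((\<Sum>n. size_fps p $ n) * (\<Sum>n. (size_fps p ^ k) $ n))"
      using sums Suc by (intro Cauchy_product_sums) (auto simp: sums_iff size_fps_nonneg)
    then show ?case
      using sums Suc by (auto simp: sums_iff fps_mult_nth atLeast0AtMost size_fps_nonneg intro!: sum_nonneg)
  qed
  have "(\<lambda>n. size_fps p $ Suc n) sums g"
    using sums by (simp add: sums_Suc_iff size_fps_0)
  have partial: "(\<Sum>k<K. pmf p k * g ^ k) \<le> g" for K
  proof -
    have "(\<lambda>n. \<Sum>k<K. pmf p k * (size_fps p ^ k) $ n) sums (\<Sum>k<K. pmf p k * g ^ k)"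
      using power by (intro sums_sum sums_mult) auto
    \<comment> \<open>Terms with k > n vanish for lack of a constant term; the others are part of
      the nonnegative sum in \<open>size_fps_Suc\<close>.\<close>
    moreover have "(\<Sum>k<K. pmf p k * (size_fps p ^ k) $ n) \<le> size_fps p $ Suc n" for n
    proof -
      have "(size_fps p ^ k) $ n = 0" if "k > n" for k
        using startsby_zero_power_prefix[OF size_fps_0] that by blast
      then have "(\<Sum>k<K. pmf p k * (size_fps p ^ k) $ n)
          = (\<Sum>k\<in>{..<K} \<inter> {0..n}. pmf p k * (size_fps p ^ k) $ n)"
        by (intro sum.mono_neutral_right) (auto intro!: leI)
      also have "\<dots> \<le> (\<Sum>k=0..n. pmf p k * (size_fps p ^ k) $ n)"
        using power by (intro sum_mono2) auto
      finally show ?thesis by (simp add: size_fps_Suc)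
    qed
    ultimately show ?thesis
      by (rule sums_le[OF _ _ \<open>(\<lambda>n. size_fps p $ Suc n) sums g\<close>, rotated])
  qed
  have "(\<lambda>k. pmf p k * g ^ k) sums generating_function p g"
    using \<open>g \<ge> 0\<close> \<open>g \<le> 1\<close> by (intro generating_function_sums) simp
  then show ?thesis
    by (metis partial suminf_le_const sums_iff)
qed

section \<open>The law of the family tree\<close>

text \<open>Phrased through the finite set \<open>labels t u\<close>, the condition is a cylinder
  event; \<open>realizes_Plane\<close> recovers the recursive reading.\<close>

definition realizes :: "(nat list \<Rightarrow> nat) \<Rightarrow> plane_tree \<Rightarrow> nat list \<Rightarrow> bool" where
  "realizes \<nu> t u \<longleftrightarrow> (\<forall>(v, k)\<in>labels t u. \<nu> v = k)"

lemma realizes_Plane: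
  "realizes \<nu> (Plane ts) u \<longleftrightarrow>
     \<nu> u = length ts \<and> (\<forall>i<length ts. realizes \<nu> (ts ! i) (u @ [i]))"
  by (auto simp: realizes_def labels_Plane case_prod_unfold simp del: labels.simps)

lemma family_tree_forget: "realizes \<nu> t u \<Longrightarrow> family_tree \<nu> u (forget t)"
proof (induction t arbitrary: u)
  case (Plane ts)
  then have "family_tree \<nu> u (Node (mset (map (\<lambda>i. forget (ts ! i)) [0..<\<nu> u])))"
    by (intro family_tree.intros) (auto simp: realizes_Plane)
  moreover have "map (\<lambda>i. forget (ts ! i)) [0..<\<nu> u] = map forget ts"
    using Plane.prems by (auto simp: realizes_Plane intro: nth_equalityI)
  ultimately show ?case by (simp del: mset_map)
qed

text \<open>The labels order the offspring, so plane trees chosen for the children assemble into one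
  for the parent.\<close>

lemma family_tree_obtains_plane_tree:
  "family_tree \<nu> u t \<Longrightarrow> \<exists>s. realizes \<nu> s u \<and> t = forget s"
proof (induction rule: family_tree.induct)
  case (1 u t)
  then obtain s where s: "\<And>i. i < \<nu> u \<Longrightarrow> realizes \<nu> (s i) (u @ [i]) \<and> t i = forget (s i)"
    by metis
  have "realizes \<nu> (Plane (map s [0..<\<nu> u])) u"
    using s by (simp add: realizes_Plane)
  moreover have "map t [0..<\<nu> u] = map forget (map s [0..<\<nu> u])"
    using s by simp
  then have "Node (mset (map t [0..<\<nu> u])) = forget (Plane (map s [0..<\<nu> u]))"
    by (simp only: forget.simps)
  ultimately show ?case by blast
qed

text \<open>Makes the events of distinct plane trees disjoint, so that their probabilities add
  up.\<close>

lemma realizes_unique: "realizes \<nu> s u \<Longrightarrow> realizes \<nu> t u \<Longrightarrow> s = t"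
proof (induction s arbitrary: t u)
  case (Plane ss)
  obtain ts where t: "t = Plane ts" by (cases t)
  have "ss = ts"
    using Plane by (intro nth_equalityI) (auto simp: t realizes_Plane)
  then show ?case by (simp add: t)
qed

lemma finite_labels: "finite (labels t u)"
  by (induction t arbitrary: u) (simp add: labels_Plane del: labels.simps)

lemma labels_prefix: "(v, k) \<in> labels t u \<Longrightarrow> \<exists>w. v = u @ w"
proof (induction t arbitrary: u)
  case (Plane ts)
  then consider "v = u" | i where "i < length ts" "(v, k) \<in> labels (ts ! i) (u @ [i])"
    unfolding labels_Plane by blast
  then show ?case
  proof cases
    case 2
    then show ?thesis using Plane.IH[of "ts ! i" "u @ [i]"] by auto
  qed simp
qed

text \<open>Labels inside the i-th subtree extend \<open>u @ [i]\<close>, hence differ from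
  \<open>u\<close> and from those of other subtrees. So \<open>labels t u\<close> is the graph of a
  partial function.\<close>

lemma labels_unique: "(v, k) \<in> labels t u \<Longrightarrow> (v, k') \<in> labels t u \<Longrightarrow> k = k'"
proof (induction t arbitrary: u)
  case (Plane ts)
  have child: "\<exists>w. v = u @ i # w" if "(v, l) \<in> labels (ts ! i) (u @ [i])" for i l
    using labels_prefix[OF that] by simp
  from Plane.prems(1) consider "v = u" "k = length ts"
    | i where "i < length ts" "(v, k) \<in> labels (ts ! i) (u @ [i])"
    unfolding labels_Plane by blast
  then show ?case
  proof cases
    case 1
    then show ?thesis using Plane.prems(2) child unfolding labels_Plane by auto
  next
    case 2
    then have "(v, k') \<in> labels (ts ! i) (u @ [i])"
      using Plane.prems(2) child unfolding labels_Plane by auto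
    then show ?thesis using Plane.IH[OF nth_mem[OF 2(1)] 2(2)] by blast
  qed
qed

lemma prod_labels: "(\<Prod>(v, k)\<in>labels t u. pmf p k) = weight p t"
proof (induction t arbitrary: u)
  case (Plane ts)
  let ?L = "\<lambda>i. labels (ts ! i) (u @ [i])"
  have child: "\<exists>w. v = u @ i # w" if "(v, l) \<in> ?L i" for v i l
    using labels_prefix[OF that] by simp
  have "(\<Prod>(v, k)\<in>labels (Plane ts) u. pmf p k)
      = pmf p (length ts) * (\<Prod>(v, k)\<in>(\<Union>i<length ts. ?L i). pmf p k)"
    unfolding labels_Plane by (subst prod.insert) (use child in \<open>auto simp: finite_labels\<close>)
  also have "(\<Prod>(v, k)\<in>(\<Union>i<length ts. ?L i). pmf p k) = (\<Prod>i<length ts. \<Prod>(v, k)\<in>?L i. pmf p k)"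
  proof (intro prod.UNION_disjoint ballI impI)
    fix i j :: nat assume "i \<noteq> j"
    then show "?L i \<inter> ?L j = {}" using child[of _ _ i] child[of _ _ j] by fastforce
  qed (simp_all add: finite_labels)
  also have "\<dots> = prod_list (map (weight p) ts)"
    using Plane by (simp add: prod.list_conv_set_nth atLeast0LessThan)
  finally show ?case by simp
qed

lemma cylinder_PiM_measure_pmf:
  fixes P :: "'i \<Rightarrow> 'a pmf"
  assumes L: "finite L" "\<And>v k k'. (v, k) \<in> L \<Longrightarrow> (v, k') \<in> L \<Longrightarrow> k = k'"
  defines "M \<equiv> PiM UNIV (\<lambda>u. measure_pmf (P u))"
  shows "{\<nu>. \<forall>(v, k)\<in>L. \<nu> v = k} \<in> sets M"
    and "emeasure M {\<nu>. \<forall>(v, k)\<in>L. \<nu> v = k} = ennreal (\<Prod>(v, k)\<in>L. pmf (P v) k)"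
proof -
  let ?X = "\<lambda>v. {k. (v, k) \<in> L}"
  let ?E = "prod_emb UNIV (\<lambda>u. measure_pmf (P u)) (fst ` L) (PiE (fst ` L) ?X)"
  have E: "{\<nu>. \<forall>(v, k)\<in>L. \<nu> v = k} = ?E"
  proof (intro set_eqI iffI)
    fix \<nu> assume "\<nu> \<in> {\<nu>. \<forall>(v, k)\<in>L. \<nu> v = k}"
    then show "\<nu> \<in> ?E" by (auto simp: prod_emb_def)
  next
    fix \<nu> assume "\<nu> \<in> ?E"
    then have "(v, \<nu> v) \<in> L" if "(v, k) \<in> L" for v k
      using that by (force simp: prod_emb_def PiE_def Pi_def)
    then show "\<nu> \<in> {\<nu>. \<forall>(v, k)\<in>L. \<nu> v = k}" using L(2) by blast
  qed
  show "{\<nu>. \<forall>(v, k)\<in>L. \<nu> v = k} \<in> sets M"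
    unfolding E M_def using L(1) by (intro sets_PiM_I) auto
  have "inj_on fst L" using L(2) by (force intro!: inj_onI)
  have "emeasure M ?E = (\<Prod>v\<in>fst ` L. emeasure (measure_pmf (P v)) (?X v))"
    unfolding M_def using L(1)
    by (intro emeasure_PiM_emb) (auto intro: measure_pmf.prob_space_axioms)
  also have "\<dots> = (\<Prod>(v, k)\<in>L. emeasure (measure_pmf (P v)) (?X v))"
    using \<open>inj_on fst L\<close> by (simp add: prod.reindex case_prod_unfold)
  also have "\<dots> = (\<Prod>(v, k)\<in>L. ennreal (pmf (P v) k))"
  proof (intro prod.cong refl, clarify)
    fix v k assume "(v, k) \<in> L"
    then have "?X v = {k}" using L(2) by blast
    then show "emeasure (measure_pmf (P v)) (?X v) = ennreal (pmf (P v) k)"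
      by (simp add: emeasure_pmf_single)
  qed
  also have "\<dots> = ennreal (\<Prod>(v, k)\<in>L. pmf (P v) k)"
    by (subst prod_ennreal[symmetric]) (auto simp: case_prod_unfold)
  finally show "emeasure M {\<nu>. \<forall>(v, k)\<in>L. \<nu> v = k} = ennreal (\<Prod>(v, k)\<in>L. pmf (P v) k)"
    unfolding E .
qed

lemma prob_space_gw_process: "prob_space (gw_process p)"
  unfolding gw_process_def by (intro prob_space_PiM measure_pmf.prob_space_axioms)

lemma space_gw_process: "space (gw_process p) = UNIV"
  by (auto simp: gw_process_def space_PiM)

lemma
  shows sets_realizes: "{\<nu>. realizes \<nu> t []} \<in> sets (gw_process p)"
    and measure_realizes_planted:
      "measure (gw_process p) {\<nu>. realizes \<nu> (Plane [t]) []} = weight p t"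
proof -
  show "{\<nu>. realizes \<nu> t []} \<in> sets (gw_process p)"
    unfolding realizes_def gw_process_def
    by (intro cylinder_PiM_measure_pmf finite_labels labels_unique)
  \<comment> \<open>All labels of the subtree start with 0. Hence the deterministic law of the
    progenitor contributes only the factor 1, and every other label carries
    \<open>p\<close>.\<close>
  have nil: "([], k) \<notin> labels t [0]" for k
    using labels_prefix[of "[]" k t "[0]"] by auto
  let ?P = "\<lambda>u :: nat list. if u = [] then return_pmf 1 else p"
  have "emeasure (gw_process p) {\<nu>. realizes \<nu> (Plane [t]) []}
      = ennreal (\<Prod>(v, k)\<in>labels (Plane [t]) []. pmf (?P v) k)"
    unfolding realizes_def gw_process_def
    by (intro cylinder_PiM_measure_pmf finite_labels labels_unique)
  also have "labels (Plane [t]) [] = insert ([], 1) (labels t [0])"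
    by (simp add: lessThan_Suc)
  also have "(\<Prod>(v, k)\<in>insert ([], 1) (labels t [0]). pmf (?P v) k) = (\<Prod>(v, k)\<in>labels t [0]. pmf (?P v) k)"
    by (subst prod.insert) (auto simp: finite_labels nil)
  also have "\<dots> = (\<Prod>(v, k)\<in>labels t [0]. pmf p k)"
    by (intro prod.cong) (auto simp: nil)
  finally show "measure (gw_process p) {\<nu>. realizes \<nu> (Plane [t]) []} = weight p t"
    by (simp add: prod_labels measure_def weight_nonneg)
qed

section \<open>From plane trees to \<open>gw_tree\<close>\<close>

lemma forget_planted: "planted (forget t) \<longleftrightarrow> (\<exists>s. t = Plane [s])"
  by (cases t) (auto simp: planted_def length_Suc_conv)

text \<open>The empty tree is excluded because it is also the placeholder for infinite or
  non-reduced outcomes; any other value comes from an actual family tree.\<close>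

lemma gw_tree_eq_iff:
  assumes "t \<noteq> empty_tree"
  shows "gw_tree \<nu> = t \<longleftrightarrow>
    (\<exists>s. realizes \<nu> (Plane [s]) [] \<and> no_degree_two (forget s) \<and> t = forget (Plane [s]))"
proof -
  have the: "gw_tree \<nu> = t'" if "t' \<in> planted_trees" "family_tree \<nu> [] t'" for t'
    using that family_tree_unique by (auto simp: gw_tree_def intro!: the_equality)
  show ?thesis
  proof
    assume t: "gw_tree \<nu> = t"
    then have "\<exists>t'\<in>planted_trees. family_tree \<nu> [] t'"
      using assms by (auto simp: gw_tree_def split: if_splits)
    then have ft: "t \<in> planted_trees" "family_tree \<nu> [] t"
      using the t by auto
    then have "reduced t" "planted t" using assms by (auto simp: planted_trees_def)
    moreover obtain s where "realizes \<nu> s []" "t = forget s"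
      using family_tree_obtains_plane_tree[OF ft(2)] by blast
    ultimately show "\<exists>s. realizes \<nu> (Plane [s]) [] \<and> no_degree_two (forget s) \<and> t = forget (Plane [s])"
      unfolding forget_planted by (auto simp: reduced_def forget_planted)
  next
    assume "\<exists>s. realizes \<nu> (Plane [s]) [] \<and> no_degree_two (forget s) \<and> t = forget (Plane [s])"
    then show "gw_tree \<nu> = t"
      by (auto intro!: the family_tree_forget[of _ "Plane [_]", simplified]
          simp: planted_trees_def reduced_def planted_def)
  qed
qed

lemma gw_tree_vimage:
  assumes "empty_tree \<notin> S"
  shows "gw_tree -` S =
    (\<Union>s\<in>{s. no_degree_two (forget s) \<and> forget (Plane [s]) \<in> S}. {\<nu>. realizes \<nu> (Plane [s]) []})"
proof (intro set_eqI)
  fix \<nu>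
  have "\<nu> \<in> gw_tree -` S \<longleftrightarrow> (\<exists>t\<in>S. gw_tree \<nu> = t)" by auto
  also have "\<dots> \<longleftrightarrow> (\<exists>t\<in>S. \<exists>s. realizes \<nu> (Plane [s]) [] \<and> no_degree_two (forget s) \<and> t = forget (Plane [s]))"
    using assms by (intro bex_cong refl gw_tree_eq_iff) auto
  finally show "\<nu> \<in> gw_tree -` S \<longleftrightarrow>
      \<nu> \<in> (\<Union>s\<in>{s. no_degree_two (forget s) \<and> forget (Plane [s]) \<in> S}. {\<nu>. realizes \<nu> (Plane [s]) []})"
    by blast
qed

text \<open>Without the placeholder, a preimage is a union of cylinder events over countably many
  plane trees. A set containing it is handled by complement.\<close>

lemma measurable_gw_tree: "gw_tree \<in> gw_process p \<rightarrow>\<^sub>M count_space planted_trees"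
proof (rule measurableI)
  fix S assume "S \<in> sets (count_space planted_trees)"
  have *: "gw_tree -` A \<in> sets (gw_process p)" if "empty_tree \<notin> A" for A
    unfolding gw_tree_vimage[OF that] by (intro sets.countable_UN') (auto simp: sets_realizes)
  show "gw_tree -` S \<inter> space (gw_process p) \<in> sets (gw_process p)"
  proof (cases "empty_tree \<in> S")
    case True
    then have "space (gw_process p) - gw_tree -` (- S) \<in> sets (gw_process p)"
      by (intro sets.compl_sets *) simp
    also have "space (gw_process p) - gw_tree -` (- S) = gw_tree -` S \<inter> space (gw_process p)"
      by auto
    finally show ?thesis .
  qed (simp add: * space_gw_process)
qed (simp add: gw_tree_in_planted_trees)

text \<open>Ensures that restricting to reduced trees discards no mass.\<close>

lemma no_degree_two_if_weight_nonzero: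
  assumes "pmf p 1 = 0"
  shows "weight p t \<noteq> 0 \<Longrightarrow> no_degree_two (forget t)"
proof (induction t)
  case (Plane ts)
  have "length ts \<noteq> 1" using Plane.prems assms by auto
  moreover have "no_degree_two (forget t)" if "t \<in> set ts" for t
    using Plane.IH[OF that] Plane.prems that by (auto simp: prod_list_zero_iff image_iff)
  ultimately show ?case by (auto intro!: no_degree_two.intros)
qed

lemma measure_num_edges_gw_tree:
  assumes "pmf p 1 = 0" "n > 0"
  shows "measure (gw_process p) {\<nu>. num_edges (gw_tree \<nu>) = n} = size_fps p $ n"
proof -
  interpret prob_space "gw_process p" by (rule prob_space_gw_process)
  let ?D = "\<lambda>s. {\<nu>. realizes \<nu> (Plane [s]) []}"
  let ?S = "{s \<in> trees_of_size n. no_degree_two (forget s)}"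
  have "{\<nu>. num_edges (gw_tree \<nu>) = n} = gw_tree -` {t. num_edges t = n}" by auto
  also have "\<dots> = (\<Union>s\<in>?S. ?D s)"
    \<comment> \<open>Since \<open>n > 0\<close>, the placeholder, which has no edges, does not
      interfere.\<close>
    using assms(2) by (subst gw_tree_vimage)
      (auto simp: empty_tree_def trees_of_size_def num_edges_forget[symmetric])
  finally have "measure (gw_process p) {\<nu>. num_edges (gw_tree \<nu>) = n} = prob (\<Union>s\<in>?S. ?D s)"
    by simp
  also have "\<dots> = (\<Sum>s\<in>?S. prob (?D s))"
    using finite_trees_of_size sets_realizes
    by (intro finite_measure_finite_Union)
       (auto simp: disjoint_family_on_def dest: realizes_unique)
  also have "\<dots> = (\<Sum>s\<in>?S. weight p s)"
    by (simp only: measure_realizes_planted)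
  also have "\<dots> = (\<Sum>s\<in>trees_of_size n. weight p s)"
    using finite_trees_of_size no_degree_two_if_weight_nonzero[OF assms(1)]
    by (intro sum.mono_neutral_left) auto
  finally show ?thesis by (simp add: size_fps_def)
qed

section \<open>The number of edges\<close>

text \<open>Solves the tree equation and rewrites \<open>(k/q gchoose (k - 1)) / k\<close> by Gamma
  values; \<open>k/q + 1 > 0\<close> keeps the numerator away from the poles.\<close>

lemma size_fps_igw:
  fixes q :: real
  assumes q: "1 / 2 \<le> q" "q < 1"
  shows "size_fps (igw_offspring q) $ n =
    (\<Sum>k=1..n. (- 1) ^ (k - 1) * real ((n - 1) choose (k - 1)) *
         (Gamma (real k / q + 1) / (fact k * Gamma (real k / q - real k + 2))) * q ^ k)"
proof -
  have coeff: "lagrange_coeff (1 / q) k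
      = (- 1) ^ (k - 1) * (Gamma (real k / q + 1) / (fact k * Gamma (real k / q - real k + 2)))"
    if k_pos: "k \<ge> 1" for k
  proof -
    obtain j where k: "k = Suc j" using k_pos by (cases k) auto
    have "real k / q + 1 > 0" using q by (intro add_nonneg_pos) auto
    then have "real k / q + 1 \<notin> \<int>\<^sub>\<le>\<^sub>0"
      using nonpos_Ints_nonpos[of "real k / q + 1"] by linarith
    from gbinomial_Gamma[OF this, of j]
    have "real k * (1 / q) gchoose j = Gamma (real k / q + 1) / (fact j * Gamma (real k / q - real k + 2))"
      by (simp add: k add_ac diff_add_eq)
    then show ?thesis
      unfolding lagrange_coeff_def by (simp add: k)
  qed
  have "size_fps (igw_offspring q) =
      fps_X * ((fps_X + fps_const q * one_minus_X_powr (1 / q)) oo size_fps (igw_offspring q))"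
    using size_fps_equation[of "igw_offspring q"] unfolding fps_igw_offspring[OF q] .
  from fps_tree_equation_solution[OF this, of n] show ?thesis
    by (auto simp: coeff mult_ac intro!: sum.cong)
qed

text \<open>Almost sure extinction: a mass g < 1 would contradict Q(g) <= g, as the term
  \<open>q (1 - g)^(1/q)\<close> is positive.\<close>

lemma size_fps_igw_sums_1:
  assumes q: "1 / 2 \<le> q" "q < 1" and sums: "fps_nth (size_fps (igw_offspring q)) sums g" and "g \<le> 1"
  shows "g = 1"
proof (rule ccontr)
  assume "g \<noteq> 1"
  with \<open>g \<le> 1\<close> have "g < 1" by simp
  moreover have "g \<ge> 0" using sums size_fps_nonneg by (metis sums_le sums_zero)
  ultimately have "generating_function (igw_offspring q) g = g + q * (1 - g) powr (1 / q)"
    by (intro generating_function_igw_offspring q) simp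
  moreover have "q * (1 - g) powr (1 / q) > 0" using q \<open>g < 1\<close> by simp
  ultimately show False
    using generating_function_total_mass_le[OF sums \<open>g \<le> 1\<close>] by simp
qed

text \<open>The hockey-stick identity, which turns the mass function into the distribution
  function.\<close>

lemma sum_choose_pred: "k \<ge> 1 \<Longrightarrow> (\<Sum>n=1..m. (n - 1) choose (k - 1)) = m choose k"
proof (induction m)
  case (Suc m)
  then show ?case by (cases k) simp_all
qed simp

theorem theorem7:
  fixes q :: real and M :: "'a measure" and T :: "'a \<Rightarrow> rtree"
  assumes "1 / 2 \<le> q" and "q < 1"
    and "prob_space M"
    and "T \<in> M \<rightarrow>\<^sub>M count_space planted_trees"
    and "distr M (count_space planted_trees) T = IGW q"
  shows "(AE \<omega> in M. 1 \<le> num_edges (T \<omega>)) \<and>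
    (\<forall>n\<ge>1. measure M {\<omega> \<in> space M. num_edges (T \<omega>) = n} =
      (\<Sum>k=1..n. (- 1) ^ (k - 1) * real ((n - 1) choose (k - 1)) *
         (Gamma (real k / q + 1) / (fact k * Gamma (real k / q - real k + 2))) * q ^ k)) \<and>
    (\<forall>x::real. x \<ge> 1 \<longrightarrow> measure M {\<omega> \<in> space M. real (num_edges (T \<omega>)) \<le> x} =
      (\<Sum>k=1..nat \<lfloor>x\<rfloor>. (- 1) ^ (k - 1) * real (nat \<lfloor>x\<rfloor> choose k) *
         (Gamma (real k / q + 1) / (fact k * Gamma (real k / q - real k + 2))) * q ^ k))"
proof -
  interpret prob_space M by fact
  note q = assms(1,2)
  let ?p = "igw_offspring q"
  let ?E = "\<lambda>n. {\<omega> \<in> space M. num_edges (T \<omega>) = n}"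
  define w where "w k = (- 1) ^ (k - 1) *
    (Gamma (real k / q + 1) / (fact k * Gamma (real k / q - real k + 2))) * q ^ k" for k
  have \<alpha>: "size_fps ?p $ n = (\<Sum>k=1..n. real ((n - 1) choose (k - 1)) * w k)" for n
    unfolding size_fps_igw[OF q] w_def by (intro sum.cong refl) (simp add: mult_ac)
  have E_sets: "{\<omega> \<in> space M. P (num_edges (T \<omega>))} \<in> events" for P
  proof -
    have "T -` {t \<in> planted_trees. P (num_edges t)} \<inter> space M \<in> events"
      using assms(4) by (rule measurable_sets) auto
    also have "T -` {t \<in> planted_trees. P (num_edges t)} \<inter> space M = {\<omega> \<in> space M. P (num_edges (T \<omega>))}"
      using measurable_space[OF assms(4)] by auto
    finally show ?thesis .
  qed
  have E_event: "?E n \<in> events" for n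
    by (rule E_sets)
  have law: "prob (?E n) = size_fps ?p $ n" if "n > 0" for n
  proof -
    let ?S = "{t \<in> planted_trees. num_edges t = n}"
    have "prob (?E n) = measure (distr M (count_space planted_trees) T) ?S"
      using assms(4) measurable_space[OF assms(4)]
      by (subst measure_distr) (auto intro!: arg_cong[where f = prob])
    also have "\<dots> = measure (gw_process ?p) (gw_tree -` ?S \<inter> space (gw_process ?p))"
      unfolding assms(5) IGW_def galton_watson_def
      by (intro measure_distr measurable_gw_tree) auto
    also have "gw_tree -` ?S \<inter> space (gw_process ?p) = {\<nu>. num_edges (gw_tree \<nu>) = n}"
      using gw_tree_in_planted_trees by (auto simp: space_gw_process)
    also have "measure (gw_process ?p) \<dots> = size_fps ?p $ n"
      by (intro measure_num_edges_gw_tree pmf_igw_offspring_1 q that)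
    finally show ?thesis .
  qed
  \<comment> \<open>The value 0 is left out because \<open>law\<close> covers only positive n; total
    mass 1 of the rest then shows that it is a null event.\<close>
  have "(\<lambda>n. prob (?E (Suc n))) sums prob (\<Union>n. ?E (Suc n))"
    by (intro finite_measure_UNION) (auto simp: disjoint_family_on_def E_event)
  then have "(\<lambda>n. size_fps ?p $ Suc n) sums prob (\<Union>n. ?E (Suc n))"
    by (simp add: law)
  then have "fps_nth (size_fps ?p) sums prob (\<Union>n. ?E (Suc n))"
    by (simp add: sums_Suc_iff size_fps_0)
  then have "prob (\<Union>n. ?E (Suc n)) = 1"
    using size_fps_igw_sums_1[OF q] by simp
  moreover have "(\<Union>n. ?E (Suc n)) = {\<omega> \<in> space M. 1 \<le> num_edges (T \<omega>)}"
    by (auto simp: gr0_conv_Suc Suc_le_eq)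
  ultimately have AE: "AE \<omega> in M. 1 \<le> num_edges (T \<omega>)"
    using AE_in_set_eq_1[OF E_sets[of "\<lambda>n. 1 \<le> n"]] by simp
  have cdf: "prob {\<omega> \<in> space M. num_edges (T \<omega>) \<le> m} = (\<Sum>k=1..m. real (m choose k) * w k)" for m
  proof -
    \<comment> \<open>The two events differ only by the null event of a tree without edges.\<close>
    have "prob {\<omega> \<in> space M. num_edges (T \<omega>) \<le> m} = prob (\<Union>n\<in>{1..m}. ?E n)"
    proof (rule finite_measure_eq_AE)
      show "AE \<omega> in M. (\<omega> \<in> {\<omega> \<in> space M. num_edges (T \<omega>) \<le> m}) = (\<omega> \<in> (\<Union>n\<in>{1..m}. ?E n))"
        using AE by eventually_elim auto
    qed (auto intro: E_sets E_event)
    also have "\<dots> = (\<Sum>n=1..m. prob (?E n))"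
      by (intro finite_measure_finite_Union) (auto simp: disjoint_family_on_def E_event)
    \<comment> \<open>Extending the inner range from n to m adds only zero binomial coefficients and
      makes the sums interchangeable.\<close>
    also have "\<dots> = (\<Sum>n=1..m. \<Sum>k=1..m. real ((n - 1) choose (k - 1)) * w k)"
      unfolding \<alpha>[symmetric]
    proof (intro sum.cong refl)
      fix n assume n: "n \<in> {1..m}"
      have "(\<Sum>k=1..n. real ((n - 1) choose (k - 1)) * w k) = (\<Sum>k=1..m. real ((n - 1) choose (k - 1)) * w k)"
        using n by (intro sum.mono_neutral_left) (auto intro!: binomial_eq_0)
      then show "prob (?E n) = (\<Sum>k=1..m. real ((n - 1) choose (k - 1)) * w k)"
        using n law[of n] \<alpha>[of n] by simp
    qed
    also have "\<dots> = (\<Sum>k=1..m. real (\<Sum>n=1..m. (n - 1) choose (k - 1)) * w k)"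
      by (subst sum.swap) (simp only: of_nat_sum sum_distrib_right)
    also have "\<dots> = (\<Sum>k=1..m. real (m choose k) * w k)"
      by (intro sum.cong refl) (simp add: sum_choose_pred[simplified])
    finally show ?thesis .
  qed
  have "prob {\<omega> \<in> space M. real (num_edges (T \<omega>)) \<le> x}
      = (\<Sum>k=1..nat \<lfloor>x\<rfloor>. (- 1) ^ (k - 1) * real (nat \<lfloor>x\<rfloor> choose k) *
         (Gamma (real k / q + 1) / (fact k * Gamma (real k / q - real k + 2))) * q ^ k)"
    if "x \<ge> 1" for x :: real
  proof -
    have "{\<omega> \<in> space M. real (num_edges (T \<omega>)) \<le> x} = {\<omega> \<in> space M. num_edges (T \<omega>) \<le> nat \<lfloor>x\<rfloor>}"
      using that by (auto simp: le_nat_floor le_floor_iff le_nat_iff)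
    then show ?thesis
      unfolding w_def using cdf[of "nat \<lfloor>x\<rfloor>"] by (simp add: w_def mult_ac)
  qed
  then show ?thesis
    using AE law size_fps_igw[OF q] by auto
qed

end
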